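(* Let $s(n,k)$ denote the number of partial packing paths with $n$ steps ending at height $k$. Then for $n\ge0$, $$s(n,2k)=w(n,k)+w(n+1,k+1)\qquad(k\ge0),$$ $$s(n,2k-1)=w(n,k+1)+2w(n-1,k)+2w(n,k)+w(n+1,k)\qquad(k\ge1),$$ and $s(n,k)=0$ otherwise, where $$w(n,k)=\sum_{i=0}^{n}(-1)^i\sum_{j=0}^{\lfloor (n-i-2k)/4\rfloor}\frac{k}{k+2j}\binom{k+2j}{j}\,t(n-i-4j-2k,\,2j+k)$$ and $$t(n,k)=\sum_{\ell=0}^{\lfloor n/2\rfloor}\binom{k+\ell-1}{\ell}\binom{\ell}{n-2\ell}2^{\,n-2\ell}.$$ Here empty sums are $0$, and the factor $\frac{k}{k+2j}\binom{k+2j}{j}$ is read as $1$ when $k=j=0$.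
   Context: Consider the hexagonal packing of the plane by circles of radius $2$ with centers $(2+4i+2j,\,2\sqrt3\,j)$, $i,j\in\mathbb Z$; the origin is the tangency point of two horizontally adjacent circles. The tangency points cut every circle into six arcs. Traversed from left to right these give six types of steps (angles measured on the circle carrying the arc): $U$ from $180^\circ$ to $120^\circ$ (displacement $(1,\sqrt3)$), $F$ from $120^\circ$ to $60^\circ$ (displacement $(2,0)$), $D$ from $60^\circ$ to $0^\circ$ (displacement $(1,-\sqrt3)$), $\overline U$ from $300^\circ$ to $360^\circ$ (displacement $(1,\sqrt3)$), $\overline F$ from $240^\circ$ to $300^\circ$ (displacement $(2,0)$), $\overline D$ from $180^\circ$ to $240^\circ$ (displacement $(1,-\sqrt3)$). A path in the packing starts at the origin, is a concatenation of such arcs of circles of the packing, each starting where the previous one ends, and stays in the quarter plane $x,y\ge 0$. Equivalently, it is a word in $\{U,F,D,\overline U,\overline F,\overline D\}$ whose first step (if any) is $U$, in which $U$ or $\overline F$ can only be followed by $F$ or $\overline U$; $F$ or $\overline D$ only by $\overline F$ or $D$; $\overline U$ or $D$ only by $U$ or $\overline D$; and which never goes below ordinate $0$. A packing path is such a path ending on the $x$-axis; a partial packing path is any prefix of a packing path. The empty path is allowed. The number of steps of a path is its number of arcs. The (final) height of a path is the integer $k$ such that its endpoint has ordinate $k\sqrt3$. Binomial coefficients $\binom{a}{b}$ use the standard convention $\binom{a}{0}=1$ for every integer $a$ (in particular $\binom{-1}{0}=1$) and $\binom{\ell-1}{\ell}=0$ for $\ell\ge1$. *)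

theory Defs
  imports "HOL-Analysis.Analysis" "HOL-Library.Sublist"
begin

text \<open>The plane is identified with the complex numbers, the point \<open>(x, y)\<close> being
  \<open>Complex x y\<close>. The constructors \<open>Ub\<close>, \<open>Fb\<close>, \<open>Db\<close> are the barred steps, i.e. the arcs
  on the lower half of a circle.\<close>

datatype step = U | F | D | Ub | Fb | Db

fun start_angle :: "step \<Rightarrow> real" where
  "start_angle U = pi"
| "start_angle F = 2 * pi / 3"
| "start_angle D = pi / 3"
| "start_angle Ub = 5 * pi / 3"
| "start_angle Fb = 4 * pi / 3"
| "start_angle Db = pi"

fun end_angle :: "step \<Rightarrow> real" where
  "end_angle U = 2 * pi / 3"
| "end_angle F = pi / 3"
| "end_angle D = 0"
| "end_angle Ub = 2 * pi"
| "end_angle Fb = 5 * pi / 3"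
| "end_angle Db = 4 * pi / 3"

definition center :: "int \<times> int \<Rightarrow> complex" where
  "center c = (case c of (i, j) \<Rightarrow>
     Complex (2 + 4 * real_of_int i + 2 * real_of_int j) (2 * sqrt 3 * real_of_int j))"

text \<open>An arc is given by its type and the index of the circle carrying it. Distinct pairs
  give distinct arcs, so counting lists of pairs is the same as counting concatenations
  of arcs.\<close>

type_synonym arc = "step \<times> (int \<times> int)"

definition arc_point :: "arc \<Rightarrow> real \<Rightarrow> complex" where
  "arc_point a \<theta> = center (snd a) + 2 * cis \<theta>"

definition arc_start :: "arc \<Rightarrow> complex" where
  "arc_start a = arc_point a (start_angle (fst a))"

definition arc_end :: "arc \<Rightarrow> complex" where
  "arc_end a = arc_point a (end_angle (fst a))"

definition arc_points :: "arc \<Rightarrow> complex set" where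
  "arc_points a = arc_point a ` closed_segment (start_angle (fst a)) (end_angle (fst a))"

definition quarter_plane :: "complex set" where
  "quarter_plane = {z. 0 \<le> Re z \<and> 0 \<le> Im z}"

definition path_in_packing :: "arc list \<Rightarrow> bool" where
  "path_in_packing as \<longleftrightarrow>
     (as \<noteq> [] \<longrightarrow> arc_start (hd as) = 0) \<and>
     (\<forall>m. Suc m < length as \<longrightarrow> arc_start (as ! Suc m) = arc_end (as ! m)) \<and>
     (\<forall>a \<in> set as. arc_points a \<subseteq> quarter_plane)"

definition path_end :: "arc list \<Rightarrow> complex" where
  "path_end as = (if as = [] then 0 else arc_end (last as))"

definition packing_path :: "arc list \<Rightarrow> bool" where
  "packing_path as \<longleftrightarrow> path_in_packing as \<and> Im (path_end as) = 0"

definition partial_packing_path :: "arc list \<Rightarrow> bool" where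
  "partial_packing_path as \<longleftrightarrow> (\<exists>bs. packing_path bs \<and> prefix as bs)"

definition s :: "nat \<Rightarrow> int \<Rightarrow> nat" where
  "s n k = card {as. partial_packing_path as \<and> length as = n \<and>
                     Im (path_end as) = real_of_int k * sqrt 3}"

text \<open>The generalised binomial coefficient is taken over the reals because its upper
  argument \<open>k + l - 1\<close> equals \<open>-1\<close> when \<open>k = l = 0\<close>.\<close>

definition t :: "nat \<Rightarrow> nat \<Rightarrow> real" where
  "t n k = (\<Sum>l = 0..n div 2.
     ((real k + real l - 1) gchoose l) * real (l choose (n - 2 * l)) * 2 ^ (n - 2 * l))"

definition ballot_factor :: "nat \<Rightarrow> nat \<Rightarrow> real" where
  "ballot_factor k j =
     (if k = 0 \<and> j = 0 then 1
      else real k / real (k + 2 * j) * real ((k + 2 * j) choose j))"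

text \<open>The first argument of \<open>w\<close> is an integer since \<open>w (-1) k\<close> is needed. Both sums run over
  integer intervals, empty when the upper bound is negative, and \<open>div\<close> on integers is the
  floor of the quotient. Inside the sums all arguments of \<open>nat\<close> are nonnegative.\<close>

definition w :: "int \<Rightarrow> nat \<Rightarrow> real" where
  "w n k = (\<Sum>i = 0..n. (-1) ^ nat i *
     (\<Sum>j = 0..(n - i - 2 * int k) div 4.
        ballot_factor k (nat j) * t (nat (n - i - 4 * j - 2 * int k)) (2 * nat j + k)))"

end

theory Submission
  imports Defs "HOL-Computational_Algebra.Formal_Power_Series"
begin

unbundle no vec_syntax
unbundle fps_syntax

text \<open>
  Every path in the packing can be completed to one ending on the axis, so partial packing paths
  are just paths in the packing. The endpoint of a path is a tangency point of one of three kinds: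
  \<open>A\<close> (horizontal tangency, even height \<open>2 j\<close>), \<open>B\<close> or \<open>C\<close> (at \<open>120\<close> or \<open>60\<close> degrees on the circle
  below it, height \<open>2 j + 1\<close>). From \<open>A\<close> the path continues by \<open>U\<close> to \<open>B\<close> or by \<open>Db\<close> to \<open>C\<close>,
  from \<open>B\<close> by \<open>F\<close> to \<open>C\<close> or by \<open>Ub\<close> to \<open>A\<close>, and from \<open>C\<close> by \<open>D\<close> to \<open>A\<close> or by \<open>Fb\<close> to \<open>B\<close>.
  Eliminating the generating functions of \<open>B\<close> and \<open>C\<close> from this automaton leaves
  \<open>(1 - x^2 - 2 x^3) A_k = x^2 (A_{k-1} + A_{k+1})\<close> with one boundary equation, which has only one
  solution. On the other side, \<open>t\<close> gives the coefficients of the powers of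
  \<open>1 / (1 - x^2 - 2 x^3)\<close>, and the ballot numbers turn the inner sum of \<open>w\<close> into the \<open>k\<close>-th power
  of a root \<open>r\<close> of \<open>r = z (1 + r^2)\<close> at \<open>z = x^2 / (1 - x^2 - 2 x^3)\<close>, which obeys the same
  recurrence; the alternating outer sum divides it by \<open>1 + x\<close>.
\<close>

section \<open>Geometry of the arcs\<close>

text \<open>Ordinates are counted in units of sqrt 3, so equality of tangency points becomes
  equality of integers and falls to \<open>presburger\<close>.\<close>

definition lattice_point :: "int \<Rightarrow> int \<Rightarrow> complex" where
  "lattice_point x y = Complex (real_of_int x) (real_of_int y * sqrt 3)"

lemma lattice_point_eq_iff [simp]: "lattice_point x y = lattice_point x' y' \<longleftrightarrow> x = x' \<and> y = y'"
  by (simp add: lattice_point_def)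

lemma lattice_point_in_quarter_plane [simp]:
  "lattice_point x y \<in> quarter_plane \<longleftrightarrow> 0 \<le> x \<and> 0 \<le> y"
  by (simp add: lattice_point_def quarter_plane_def zero_le_mult_iff)

lemma cis_angles:
  "cis (2 * pi / 3) = Complex (- 1 / 2) (sqrt 3 / 2)"
  "cis (pi / 3) = Complex (1 / 2) (sqrt 3 / 2)"
  "cis (5 * pi / 3) = Complex (1 / 2) (- sqrt 3 / 2)"
  "cis (4 * pi / 3) = Complex (- 1 / 2) (- sqrt 3 / 2)"
proof -
  show "cis (2 * pi / 3) = Complex (- 1 / 2) (sqrt 3 / 2)"
    "cis (pi / 3) = Complex (1 / 2) (sqrt 3 / 2)"
    by (simp_all add: complex_eq_iff cos_120 sin_120 cos_60 sin_60)
  have e: "5 * pi / 3 = 2 * pi - pi / 3" "4 * pi / 3 = pi + pi / 3" by simp_all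
  have "cos (5 * pi / 3) = 1 / 2" "sin (5 * pi / 3) = - sqrt 3 / 2"
    "cos (4 * pi / 3) = - 1 / 2" "sin (4 * pi / 3) = - sqrt 3 / 2"
    unfolding e cos_diff sin_diff cos_add sin_add cos_60 sin_60 by simp_all
  then show "cis (5 * pi / 3) = Complex (1 / 2) (- sqrt 3 / 2)"
    "cis (4 * pi / 3) = Complex (- 1 / 2) (- sqrt 3 / 2)"
    by (simp_all only: complex_eq_iff cis.sel complex.sel)
qed

lemma arc_start_simps [simp]:
  "arc_start (U, (i, j)) = lattice_point (4 * i + 2 * j) (2 * j)"
  "arc_start (F, (i, j)) = lattice_point (4 * i + 2 * j + 1) (2 * j + 1)"
  "arc_start (D, (i, j)) = lattice_point (4 * i + 2 * j + 3) (2 * j + 1)"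
  "arc_start (Ub, (i, j)) = lattice_point (4 * i + 2 * j + 3) (2 * j - 1)"
  "arc_start (Fb, (i, j)) = lattice_point (4 * i + 2 * j + 1) (2 * j - 1)"
  "arc_start (Db, (i, j)) = lattice_point (4 * i + 2 * j) (2 * j)"
  unfolding arc_start_def arc_point_def fst_conv snd_conv start_angle.simps cis_angles
  by (simp_all add: center_def lattice_point_def complex_eq_iff algebra_simps)

lemma arc_end_simps [simp]:
  "arc_end (U, (i, j)) = lattice_point (4 * i + 2 * j + 1) (2 * j + 1)"
  "arc_end (F, (i, j)) = lattice_point (4 * i + 2 * j + 3) (2 * j + 1)"
  "arc_end (D, (i, j)) = lattice_point (4 * i + 2 * j + 4) (2 * j)"
  "arc_end (Ub, (i, j)) = lattice_point (4 * i + 2 * j + 4) (2 * j)"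
  "arc_end (Fb, (i, j)) = lattice_point (4 * i + 2 * j + 3) (2 * j - 1)"
  "arc_end (Db, (i, j)) = lattice_point (4 * i + 2 * j + 1) (2 * j - 1)"
  unfolding arc_end_def arc_point_def fst_conv snd_conv end_angle.simps cis_angles
  by (simp_all add: center_def lattice_point_def complex_eq_iff algebra_simps)

lemma cos_ge_half: "0 \<le> \<theta> \<Longrightarrow> \<theta> \<le> pi / 3 \<Longrightarrow> 1 / 2 \<le> cos \<theta>"
  using cos_monotone_0_pi_le[of \<theta> "pi / 3"] by (simp add: cos_60)

lemma cos_ge_neg_half: "0 \<le> \<theta> \<Longrightarrow> \<theta> \<le> 2 * pi / 3 \<Longrightarrow> - 1 / 2 \<le> cos \<theta>"
  using cos_monotone_0_pi_le[of \<theta> "2 * pi / 3"] by (simp add: cos_120)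

text \<open>Arcs run from left to right, so the abscissa is least at the start. Upper arcs stay
  above the height of their centre. If both ends of a lower arc have nonnegative height, the row
  index of its circle is at least 1, and the centre is then higher than the radius.\<close>

lemma arc_in_quarter_plane_iff:
  "arc_points a \<subseteq> quarter_plane \<longleftrightarrow> arc_start a \<in> quarter_plane \<and> arc_end a \<in> quarter_plane"
proof
  assume "arc_points a \<subseteq> quarter_plane"
  then show "arc_start a \<in> quarter_plane \<and> arc_end a \<in> quarter_plane"
    by (auto simp: arc_points_def arc_start_def arc_end_def)
next
  assume ends: "arc_start a \<in> quarter_plane \<and> arc_end a \<in> quarter_plane"
  obtain st i j where a: "a = (st, (i, j))" by (metis prod.collapse)
  have upper: "0 \<le> 2 * sqrt 3 * real_of_int j + 2 * sin \<theta>" if "0 \<le> j" "0 \<le> \<theta>" "\<theta> \<le> pi" for \<theta>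
    using that sin_ge_zero[of \<theta>] by simp
  have lower: "0 \<le> 2 * sqrt 3 * real_of_int j + 2 * sin \<theta>" if "1 \<le> j" for \<theta>
  proof -
    have "1 * 1 \<le> sqrt 3 * real_of_int j"
      by (rule mult_mono) (use that in auto)
    with sin_ge_minus_one[of \<theta>] show ?thesis by linarith
  qed
  \<comment> \<open>Reflection in the horizontal diameter carries the cosine bounds of the upper
    arcs over to \<open>Ub\<close> and \<open>Fb\<close>.\<close>
  have cos_reflect: "cos (2 * pi - \<theta>) = cos \<theta>" for \<theta> by (simp add: cos_diff)
  show "arc_points a \<subseteq> quarter_plane"
  proof
    fix z assume "z \<in> arc_points a"
    then obtain \<theta> where \<theta>: "\<theta> \<in> closed_segment (start_angle st) (end_angle st)"
      and z: "z = center (i, j) + 2 * cis \<theta>"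
      by (auto simp: arc_points_def arc_point_def a)
    have zc: "Re z = 2 + 4 * real_of_int i + 2 * real_of_int j + 2 * cos \<theta>"
      "Im z = 2 * sqrt 3 * real_of_int j + 2 * sin \<theta>"
      by (simp_all add: z center_def)
    have "0 \<le> Re z \<and> 0 \<le> Im z"
    proof (cases st)
      case U
      then have j: "0 \<le> j" and "0 \<le> 4 * i + 2 * j" and b: "0 \<le> \<theta>" "\<theta> \<le> pi"
        using ends \<theta> by (auto simp: a closed_segment_eq_real_ivl not_le[THEN iffD2, OF pi_gt_zero])
      then have "0 \<le> 4 * real_of_int i + 2 * real_of_int j" by linarith
      moreover have "- 1 \<le> cos \<theta>" by simp
      moreover have "0 \<le> Im z" unfolding zc using j b pi_gt_zero by (intro upper) linarith+
      ultimately show ?thesis unfolding zc(1) by linarith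
    next
      case F
      then have j: "0 \<le> j" and "0 \<le> 4 * i + 2 * j + 1" and b: "0 \<le> \<theta>" "\<theta> \<le> 2 * pi / 3"
        using ends \<theta> by (auto simp: a closed_segment_eq_real_ivl not_le[THEN iffD2, OF pi_gt_zero])
      then have "0 \<le> 4 * real_of_int i + 2 * real_of_int j + 1" by linarith
      moreover have "- 1 / 2 \<le> cos \<theta>" using b by (rule cos_ge_neg_half)
      moreover have "0 \<le> Im z" unfolding zc using j b pi_gt_zero by (intro upper) linarith+
      ultimately show ?thesis unfolding zc(1) by linarith
    next
      case D
      then have j: "0 \<le> j" and "0 \<le> 4 * i + 2 * j + 3" and b: "0 \<le> \<theta>" "\<theta> \<le> pi / 3"
        using ends \<theta> by (auto simp: a closed_segment_eq_real_ivl not_le[THEN iffD2, OF pi_gt_zero])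
      then have "0 \<le> 4 * real_of_int i + 2 * real_of_int j + 3" by linarith
      moreover have "1 / 2 \<le> cos \<theta>" using b by (rule cos_ge_half)
      moreover have "0 \<le> Im z" unfolding zc using j b pi_gt_zero by (intro upper) linarith+
      ultimately show ?thesis unfolding zc(1) by linarith
    next
      case Ub
      then have j: "1 \<le> j" and "0 \<le> 4 * i + 2 * j + 3" and b: "5 * pi / 3 \<le> \<theta>" "\<theta> \<le> 2 * pi"
        using ends \<theta> by (auto simp: a closed_segment_eq_real_ivl not_le[THEN iffD2, OF pi_gt_zero])
      then have "0 \<le> 4 * real_of_int i + 2 * real_of_int j + 3" by linarith
      moreover have "1 / 2 \<le> cos \<theta>"
        using cos_ge_half[of "2 * pi - \<theta>"] b pi_gt_zero unfolding cos_reflect by linarith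
      moreover have "0 \<le> Im z" unfolding zc using j by (rule lower)
      ultimately show ?thesis unfolding zc(1) by linarith
    next
      case Fb
      then have j: "1 \<le> j" and "0 \<le> 4 * i + 2 * j + 1" and b: "4 * pi / 3 \<le> \<theta>" "\<theta> \<le> 5 * pi / 3"
        using ends \<theta> by (auto simp: a closed_segment_eq_real_ivl not_le[THEN iffD2, OF pi_gt_zero])
      then have "0 \<le> 4 * real_of_int i + 2 * real_of_int j + 1" by linarith
      moreover have "- 1 / 2 \<le> cos \<theta>"
        using cos_ge_neg_half[of "2 * pi - \<theta>"] b pi_gt_zero unfolding cos_reflect by linarith
      moreover have "0 \<le> Im z" unfolding zc using j by (rule lower)
      ultimately show ?thesis unfolding zc(1) by linarith
    next
      case Db
      then have j: "1 \<le> j" and "0 \<le> 4 * i + 2 * j"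
        using ends by (auto simp: a)
      then have "0 \<le> 4 * real_of_int i + 2 * real_of_int j" by linarith
      moreover have "- 1 \<le> cos \<theta>" by simp
      moreover have "0 \<le> Im z" unfolding zc using j by (rule lower)
      ultimately show ?thesis unfolding zc(1) by linarith
    qed
    then show "z \<in> quarter_plane" by (simp add: quarter_plane_def)
  qed
qed

lemma path_end_snoc [simp]: "path_end (as @ [a]) = arc_end a"
  by (simp add: path_end_def)

lemma path_in_packing_Nil [simp]: "path_in_packing []"
  by (simp add: path_in_packing_def)

text \<open>Turns the indexwise definition into one that grows at the right end, as needed for
  induction on paths and for counting by length.\<close>

lemma path_in_packing_snoc:
  "path_in_packing (as @ [a]) \<longleftrightarrow>
     path_in_packing as \<and> arc_start a = path_end as \<and> arc_points a \<subseteq> quarter_plane"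
proof (cases "as = []")
  case True
  then show ?thesis by (auto simp: path_in_packing_def path_end_def)
next
  case False
  have "(\<forall>m. Suc m < length (as @ [a]) \<longrightarrow> arc_start ((as @ [a]) ! Suc m) = arc_end ((as @ [a]) ! m)) \<longleftrightarrow>
    (\<forall>m. Suc m < length as \<longrightarrow> arc_start (as ! Suc m) = arc_end (as ! m)) \<and> arc_start a = arc_end (last as)"
    (is "?L \<longleftrightarrow> ?R")
  proof
    assume L: ?L
    have "arc_start (as ! Suc m) = arc_end (as ! m)" if "Suc m < length as" for m
      using L[rule_format, of m] that by (simp add: nth_append)
    moreover have "arc_start a = arc_end (last as)"
      using L[rule_format, of "length as - 1"] False by (simp add: nth_append last_conv_nth)
    ultimately show ?R by blast
  next
    assume R: ?R
    show ?L
    proof (intro allI impI)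
      fix m assume "Suc m < length (as @ [a])"
      then consider "Suc m < length as" | "Suc m = length as" by fastforce
      then show "arc_start ((as @ [a]) ! Suc m) = arc_end ((as @ [a]) ! m)"
      proof cases
        case 1
        then show ?thesis using R by (simp add: nth_append)
      next
        case 2
        then have "m = length as - 1" by simp
        then show ?thesis using R 2 False by (simp add: nth_append last_conv_nth)
      qed
    qed
  qed
  then show ?thesis
    unfolding path_in_packing_def path_end_def using False by auto
qed

section \<open>Transitions between tangency points\<close>

text \<open>Each tangency point is assigned to one circle \<open>(i, j)\<close>, here as its
  leftmost point, below as its point at 120 or 60 degrees. The rightmost point is the leftmost one
  of the next circle; the points at 300 and 240 degrees are B and C points of the row below.\<close>

definition vertices_A :: "int \<Rightarrow> complex set" where
  "vertices_A j = {lattice_point (4 * i + 2 * j) (2 * j) |i. 0 \<le> 4 * i + 2 * j}"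

definition vertices_B :: "int \<Rightarrow> complex set" where
  "vertices_B j = {lattice_point (4 * i + 2 * j + 1) (2 * j + 1) |i. 0 \<le> 4 * i + 2 * j + 1}"

definition vertices_C :: "int \<Rightarrow> complex set" where
  "vertices_C j = {lattice_point (4 * i + 2 * j + 3) (2 * j + 1) |i. 0 \<le> 4 * i + 2 * j + 3}"

definition vertices :: "complex set" where
  "vertices = (\<Union>j\<in>{0..}. vertices_A j \<union> vertices_B j \<union> vertices_C j)"

lemma vertices_cases:
  assumes "z \<in> vertices"
  obtains i j where "z = lattice_point (4 * i + 2 * j) (2 * j)" "0 \<le> 4 * i + 2 * j" "0 \<le> j"
  | i j where "z = lattice_point (4 * i + 2 * j + 1) (2 * j + 1)" "0 \<le> 4 * i + 2 * j + 1" "0 \<le> j"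
  | i j where "z = lattice_point (4 * i + 2 * j + 3) (2 * j + 1)" "0 \<le> 4 * i + 2 * j + 3" "0 \<le> j"
  using assms unfolding vertices_def vertices_A_def vertices_B_def vertices_C_def by auto

text \<open>Eliminating the circle index leaves a congruence modulo 4, so membership becomes a
  question of linear integer arithmetic.\<close>

lemma lattice_point_in_vertices_A:
  "lattice_point x y \<in> vertices_A j \<longleftrightarrow> 0 \<le> x \<and> y = 2 * j \<and> 4 dvd x - y"
  unfolding vertices_A_def mem_Collect_eq lattice_point_eq_iff by presburger

lemma lattice_point_in_vertices_B:
  "lattice_point x y \<in> vertices_B j \<longleftrightarrow> 0 \<le> x \<and> y = 2 * j + 1 \<and> 4 dvd x - y"
  unfolding vertices_B_def mem_Collect_eq lattice_point_eq_iff by presburger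

lemma lattice_point_in_vertices_C:
  "lattice_point x y \<in> vertices_C j \<longleftrightarrow> 0 \<le> x \<and> y = 2 * j + 1 \<and> 4 dvd x - y - 2"
  unfolding vertices_C_def mem_Collect_eq lattice_point_eq_iff by presburger

lemmas lattice_point_in_vertices =
  lattice_point_in_vertices_A lattice_point_in_vertices_B lattice_point_in_vertices_C

lemma lattice_point_in_vertices_iff:
  "lattice_point x y \<in> vertices \<longleftrightarrow>
     0 \<le> x \<and> 0 \<le> y \<and> (4 dvd x - y \<or> odd y \<and> 4 dvd x - y - 2)"
  unfolding vertices_def UN_iff Un_iff lattice_point_in_vertices atLeast_iff Bex_def by presburger

definition next_arcs :: "complex \<Rightarrow> arc set" where
  "next_arcs z = {a. arc_start a = z \<and> arc_points a \<subseteq> quarter_plane}"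

text \<open>The only place where the boundary is felt: \<open>Db\<close> from height 0 would go
  below the axis. Elsewhere abscissas only grow, and a descent from an odd height ends at height 0
  or more.\<close>

lemma next_arcs_A:
  assumes "0 \<le> 4 * i + 2 * j" "0 \<le> j"
  shows "next_arcs (lattice_point (4 * i + 2 * j) (2 * j)) =
    (if j = 0 then {(U, (i, j))} else {(U, (i, j)), (Db, (i, j))})"
proof -
  have "(st, (i', j')) \<in> next_arcs (lattice_point (4 * i + 2 * j) (2 * j)) \<longleftrightarrow>
      (st, (i', j')) \<in> (if j = 0 then {(U, (i, j))} else {(U, (i, j)), (Db, (i, j))})" for st i' j'
    using assms by (cases "j = 0"; cases st; simp add: next_arcs_def arc_in_quarter_plane_iff; presburger)
  then show ?thesis by (intro set_eqI) (metis prod.collapse)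
qed

text \<open>The point at 120 degrees of circle \<open>(i, j)\<close> is the point at 300 degrees of
  its upper left neighbour \<open>(i - 1, j + 1)\<close>.\<close>

lemma next_arcs_B:
  assumes "0 \<le> 4 * i + 2 * j + 1" "0 \<le> j"
  shows "next_arcs (lattice_point (4 * i + 2 * j + 1) (2 * j + 1)) =
    {(F, (i, j)), (Ub, (i - 1, j + 1))}"
proof -
  have "(st, (i', j')) \<in> next_arcs (lattice_point (4 * i + 2 * j + 1) (2 * j + 1)) \<longleftrightarrow>
      (st, (i', j')) \<in> {(F, (i, j)), (Ub, (i - 1, j + 1))}" for st i' j'
    using assms by (cases st) (simp_all add: next_arcs_def arc_in_quarter_plane_iff; presburger)+
  then show ?thesis by (intro set_eqI) (metis prod.collapse)
qed

lemma next_arcs_C: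
  assumes "0 \<le> 4 * i + 2 * j + 3" "0 \<le> j"
  shows "next_arcs (lattice_point (4 * i + 2 * j + 3) (2 * j + 1)) =
    {(D, (i, j)), (Fb, (i, j + 1))}"
proof -
  have "(st, (i', j')) \<in> next_arcs (lattice_point (4 * i + 2 * j + 3) (2 * j + 1)) \<longleftrightarrow>
      (st, (i', j')) \<in> {(D, (i, j)), (Fb, (i, j + 1))}" for st i' j'
    using assms by (cases st) (simp_all add: next_arcs_def arc_in_quarter_plane_iff; presburger)+
  then show ?thesis by (intro set_eqI) (metis prod.collapse)
qed

lemma finite_next_arcs: "z \<in> vertices \<Longrightarrow> finite (next_arcs z)"
  by (erule vertices_cases) (simp_all add: next_arcs_A next_arcs_B next_arcs_C)

lemma arc_end_in_vertices:
  assumes "z \<in> vertices" "a \<in> next_arcs z"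
  shows "arc_end a \<in> vertices"
  using assms(1)
proof (cases rule: vertices_cases)
  case (1 i j)
  then show ?thesis
    using assms(2) by (auto simp: next_arcs_A lattice_point_in_vertices_iff split: if_splits)
next
  case (2 i j)
  then show ?thesis
    using assms(2) by (auto simp: next_arcs_B lattice_point_in_vertices_iff)
next
  case (3 i j)
  then show ?thesis
    using assms(2) by (auto simp: next_arcs_C lattice_point_in_vertices_iff)
qed

lemma zero_eq_lattice_point: "0 = lattice_point 0 0"
  by (simp add: lattice_point_def complex_eq_iff)

lemma path_end_in_vertices: "path_in_packing as \<Longrightarrow> path_end as \<in> vertices"
proof (induction as rule: rev_induct)
  case Nil
  have "lattice_point 0 0 \<in> vertices_A 0" by (simp add: lattice_point_in_vertices)
  then show ?case by (auto simp: path_end_def vertices_def zero_eq_lattice_point)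
next
  case (snoc a as)
  then show ?case
    by (auto simp: path_in_packing_snoc next_arcs_def intro: arc_end_in_vertices)
qed

section \<open>Counting paths by their final vertex\<close>

definition paths :: "nat \<Rightarrow> arc list set" where
  "paths n = {as. path_in_packing as \<and> length as = n}"

lemma paths_0: "paths 0 = {[]}"
  by (auto simp: paths_def)

lemma paths_Suc: "paths (Suc n) = (\<lambda>(as, a). as @ [a]) ` (SIGMA as:paths n. next_arcs (path_end as))"
proof (intro set_eqI iffI)
  fix bs assume bs: "bs \<in> paths (Suc n)"
  then obtain as a where "bs = as @ [a]" "length as = n"
    by (auto simp: paths_def length_Suc_conv_rev)
  with bs show "bs \<in> (\<lambda>(as, a). as @ [a]) ` (SIGMA as:paths n. next_arcs (path_end as))"
    by (force simp: paths_def path_in_packing_snoc next_arcs_def)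
qed (auto simp: paths_def path_in_packing_snoc next_arcs_def)

lemma finite_paths: "finite (paths n)"
proof (induction n)
  case (Suc n)
  then show ?case
    unfolding paths_Suc
    by (intro finite_imageI finite_SigmaI finite_next_arcs path_end_in_vertices) (auto simp: paths_def)
qed (simp add: paths_0)

definition num_paths :: "nat \<Rightarrow> complex set \<Rightarrow> nat" where
  "num_paths n S = card {as \<in> paths n. path_end as \<in> S}"

lemma num_paths_eq_sum: "num_paths n S = (\<Sum>as\<in>paths n. of_bool (path_end as \<in> S))"
  by (simp add: num_paths_def finite_paths Int_def)

lemma num_paths_Suc:
  "num_paths (Suc n) S = (\<Sum>as\<in>paths n. \<Sum>a\<in>next_arcs (path_end as). of_bool (arc_end a \<in> S))"
proof -
  have inj: "inj_on (\<lambda>(as, a). as @ [a]) (SIGMA as:paths n. next_arcs (path_end as))"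
    by (auto simp: inj_on_def)
  have "num_paths (Suc n) S =
      (\<Sum>(as, a)\<in>(SIGMA as:paths n. next_arcs (path_end as)). of_bool (arc_end a \<in> S))"
    unfolding num_paths_eq_sum paths_Suc sum.reindex[OF inj] by (auto intro!: sum.cong)
  also have "\<dots> = (\<Sum>as\<in>paths n. \<Sum>a\<in>next_arcs (path_end as). of_bool (arc_end a \<in> S))"
    by (intro sum.Sigma[symmetric] finite_paths ballI finite_next_arcs path_end_in_vertices)
      (simp add: paths_def)
  finally show ?thesis .
qed

text \<open>Reduces each recurrence for path counts to a local check: the arcs from a vertex into
  \<open>S\<close> are counted by its membership in two vertex classes.\<close>

lemma num_paths_Suc_eq_add:
  assumes "\<And>z. z \<in> vertices \<Longrightarrow>
    (\<Sum>a\<in>next_arcs z. of_bool (arc_end a \<in> S)) = of_bool (z \<in> T1) + (of_bool (z \<in> T2) :: nat)"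
  shows "num_paths (Suc n) S = num_paths n T1 + num_paths n T2"
  unfolding num_paths_Suc unfolding num_paths_eq_sum sum.distrib[symmetric]
  by (rule sum.cong[OF refl], rule assms, rule path_end_in_vertices) (simp add: paths_def)

lemma not_4_dvd:
  fixes i :: int
  shows "\<not> 4 dvd 4 * i + 2" "\<not> 4 dvd 2 + 4 * i" "\<not> 4 dvd 4 * i - 2"
  by presburger+

lemma num_paths_Suc_A:
  "num_paths (Suc n) (vertices_A j) = num_paths n (vertices_B (j - 1)) + num_paths n (vertices_C j)"
  by (rule num_paths_Suc_eq_add, erule vertices_cases)
    (auto simp: next_arcs_A next_arcs_B next_arcs_C lattice_point_in_vertices not_4_dvd
      simp del: sum_of_bool_eq, (presburger+)?)

lemma num_paths_Suc_B:
  "0 \<le> j \<Longrightarrow> num_paths (Suc n) (vertices_B j) = num_paths n (vertices_A j) + num_paths n (vertices_C j)"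
  by (rule num_paths_Suc_eq_add, erule vertices_cases)
    (auto simp: next_arcs_A next_arcs_B next_arcs_C lattice_point_in_vertices not_4_dvd
      simp del: sum_of_bool_eq, (presburger+)?)

text \<open>The hypothesis excludes \<open>j = - 1\<close>, where the arc \<open>Db\<close> from
  \<open>vertices_A 0\<close> would leave the quarter plane.\<close>

lemma num_paths_Suc_C:
  "0 \<le> j \<Longrightarrow> num_paths (Suc n) (vertices_C j) = num_paths n (vertices_A (j + 1)) + num_paths n (vertices_B j)"
  by (rule num_paths_Suc_eq_add, erule vertices_cases)
    (auto simp: next_arcs_A next_arcs_B next_arcs_C lattice_point_in_vertices not_4_dvd
      simp del: sum_of_bool_eq, (presburger+)?)

lemma num_paths_0:
  "num_paths 0 (vertices_A j) = of_bool (j = 0)" "num_paths 0 (vertices_B j) = 0"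
  "num_paths 0 (vertices_C j) = 0"
  by (auto simp: num_paths_eq_sum paths_0 path_end_def zero_eq_lattice_point
      lattice_point_in_vertices) presburger

text \<open>Removes the term that \<open>num_paths_Suc_A\<close> produces at \<open>j = 0\<close>:
  those vertices lie below the axis.\<close>

lemma num_paths_B_neg: "num_paths n (vertices_B (- 1)) = 0"
proof -
  have "path_end as \<notin> vertices_B (- 1)" if "as \<in> paths n" for as
    using that path_end_in_vertices[of as]
    by (auto simp: paths_def lattice_point_in_vertices elim!: vertices_cases)
  then show ?thesis by (simp add: num_paths_eq_sum)
qed

section \<open>Completing a path to one that ends on the axis\<close>

lemma path_in_packing_extend:
  assumes "path_in_packing as" "a \<in> next_arcs (path_end as)"
  shows "path_in_packing (as @ [a])"
  using assms by (simp add: path_in_packing_snoc next_arcs_def)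

text \<open>\<open>Db\<close> followed by \<open>D\<close> descends from one even height to the next
  lower one.\<close>

lemma extend_A:
  "path_in_packing as \<Longrightarrow> path_end as \<in> vertices_A (int k) \<Longrightarrow> \<exists>bs. packing_path (as @ bs)"
proof (induction k arbitrary: as)
  case 0
  then have "packing_path (as @ [])"
    by (auto simp: packing_path_def vertices_A_def lattice_point_def)
  then show ?case by blast
next
  case (Suc k)
  define j where "j = int (Suc k)"
  obtain i where i: "path_end as = lattice_point (4 * i + 2 * j) (2 * j)" "0 \<le> 4 * i + 2 * j"
    using Suc.prems(2) unfolding j_def by (auto simp: vertices_A_def)
  let ?as = "as @ [(Db, (i, j))]" let ?as' = "?as @ [(D, (i, j - 1))]"
  have "(Db, (i, j)) \<in> next_arcs (path_end as)"
    unfolding i(1) by (subst next_arcs_A) (use i(2) in \<open>simp_all add: j_def\<close>)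
  then have "path_in_packing ?as"
    using Suc.prems(1) by (rule path_in_packing_extend[rotated])
  \<comment> \<open>The end of \<open>Db\<close> is rewritten as a C vertex of row
    \<open>j - 1\<close>, the shape that \<open>next_arcs_C\<close> expects.\<close>
  moreover have "path_end ?as = lattice_point (4 * i + 2 * (j - 1) + 3) (2 * (j - 1) + 1)"
    by (simp add: algebra_simps)
  then have "(D, (i, j - 1)) \<in> next_arcs (path_end ?as)"
    by (simp only:, subst next_arcs_C) (use i(2) in \<open>simp_all add: j_def\<close>)
  ultimately have "path_in_packing ?as'"
    by (rule path_in_packing_extend)
  moreover have "path_end ?as' \<in> vertices_A (int k)"
    unfolding path_end_snoc using i by (simp add: lattice_point_in_vertices j_def)
  ultimately obtain bs where "packing_path (?as' @ bs)"
    using Suc.IH by blast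
  then show ?case by (metis append.assoc)
qed

lemma extend_C:
  assumes "path_in_packing as" "path_end as \<in> vertices_C j" "0 \<le> j"
  shows "\<exists>bs. packing_path (as @ bs)"
proof -
  obtain i where i: "path_end as = lattice_point (4 * i + 2 * j + 3) (2 * j + 1)" "0 \<le> 4 * i + 2 * j + 3"
    using assms(2) by (auto simp: vertices_C_def)
  let ?as = "as @ [(D, (i, j))]"
  have "path_in_packing ?as"
    using assms i by (intro path_in_packing_extend) (simp_all add: next_arcs_C)
  moreover have "path_end ?as \<in> vertices_A (int (nat j))"
    using i assms(3) by (simp add: lattice_point_in_vertices)
  ultimately obtain bs where "packing_path (?as @ bs)"
    using extend_A by blast
  then show ?thesis by (metis append.assoc)
qed

lemma extend_B:
  assumes "path_in_packing as" "path_end as \<in> vertices_B j" "0 \<le> j"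
  shows "\<exists>bs. packing_path (as @ bs)"
proof -
  obtain i where i: "path_end as = lattice_point (4 * i + 2 * j + 1) (2 * j + 1)" "0 \<le> 4 * i + 2 * j + 1"
    using assms(2) by (auto simp: vertices_B_def)
  let ?as = "as @ [(F, (i, j))]"
  have "path_in_packing ?as"
    using assms i by (intro path_in_packing_extend) (simp_all add: next_arcs_B)
  moreover have "path_end ?as \<in> vertices_C j"
    using i assms(3) by (simp add: lattice_point_in_vertices)
  ultimately obtain bs where "packing_path (?as @ bs)"
    using extend_C assms(3) by blast
  then show ?thesis by (metis append.assoc)
qed

lemma path_in_packing_prefix: "path_in_packing (as @ bs) \<Longrightarrow> path_in_packing as"
  by (induction bs rule: rev_induct) (simp_all only: append_Nil2 append.assoc[symmetric] path_in_packing_snoc)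

lemma partial_packing_path_iff: "partial_packing_path as \<longleftrightarrow> path_in_packing as"
proof
  assume "partial_packing_path as"
  then show "path_in_packing as"
    by (auto simp: partial_packing_path_def packing_path_def prefix_def intro: path_in_packing_prefix)
next
  assume pip: "path_in_packing as"
  then obtain j where "0 \<le> j" "path_end as \<in> vertices_A j \<union> vertices_B j \<union> vertices_C j"
    using path_end_in_vertices by (auto simp: vertices_def)
  moreover from this(1) obtain k where "j = int k" by (metis nonneg_int_cases)
  ultimately have "\<exists>bs. packing_path (as @ bs)"
    using pip extend_A extend_B extend_C by blast
  then show "partial_packing_path as"
    by (auto simp: partial_packing_path_def)
qed

section \<open>Final heights in terms of vertex classes\<close>

lemma s_eq: "s n k = card {as \<in> paths n. Im (path_end as) = real_of_int k * sqrt 3}"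
  unfolding s_def paths_def partial_packing_path_iff mem_Collect_eq conj_assoc ..

lemma Im_lattice_point_eq [simp]: "Im (lattice_point x y) = real_of_int k * sqrt 3 \<longleftrightarrow> y = k"
  by (simp add: lattice_point_def)

lemma s_even: "s n (2 * j) = num_paths n (vertices_A j)"
proof -
  have "Im z = real_of_int (2 * j) * sqrt 3 \<longleftrightarrow> z \<in> vertices_A j" if "z \<in> vertices" for z
    using that by (rule vertices_cases) (simp only: Im_lattice_point_eq lattice_point_in_vertices, presburger)+
  then show ?thesis
    unfolding s_eq num_paths_def
    by (intro arg_cong[where f = card] Collect_cong conj_cong refl) (simp add: paths_def path_end_in_vertices)
qed

text \<open>Both B and C vertices have odd height; abscissa minus height modulo 4 tells them
  apart.\<close>

lemma s_odd: "s n (2 * j + 1) = num_paths n (vertices_B j) + num_paths n (vertices_C j)"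
proof -
  have "Im z = real_of_int (2 * j + 1) * sqrt 3 \<longleftrightarrow> z \<in> vertices_B j \<union> vertices_C j" if "z \<in> vertices" for z
    using that by (rule vertices_cases)
      (simp only: Im_lattice_point_eq lattice_point_in_vertices Un_iff, presburger)+
  then have "{as \<in> paths n. Im (path_end as) = real_of_int (2 * j + 1) * sqrt 3} =
      {as \<in> paths n. path_end as \<in> vertices_B j} \<union> {as \<in> paths n. path_end as \<in> vertices_C j}"
    using path_end_in_vertices unfolding paths_def by blast
  moreover have "vertices_B j \<inter> vertices_C j = {}"
    unfolding vertices_B_def vertices_C_def by (auto; presburger)
  then have "{as \<in> paths n. path_end as \<in> vertices_B j} \<inter> {as \<in> paths n. path_end as \<in> vertices_C j} = {}"
    by blast
  ultimately show ?thesis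
    unfolding s_eq num_paths_def by (simp only:) (simp add: card_Un_disjoint finite_paths)
qed

lemma s_neg:
  assumes "k < 0"
  shows "s n k = 0"
proof -
  have "Im z \<noteq> real_of_int k * sqrt 3" if "z \<in> vertices" for z
    using that by (rule vertices_cases) (simp only: Im_lattice_point_eq, use assms in presburger)+
  then have "{as \<in> paths n. Im (path_end as) = real_of_int k * sqrt 3} = {}"
    using path_end_in_vertices unfolding paths_def by blast
  then show ?thesis by (simp only: s_eq card.empty)
qed

section \<open>Generating functions of \<open>t\<close> and \<open>w\<close>\<close>

text \<open>The binomial series of \<open>(1 - x)^(-k)\<close>, which is 1 for \<open>k = 0\<close>
  thanks to the convention for upper argument -1.\<close>

definition neg_binomial_fps :: "nat \<Rightarrow> real fps" where
  "neg_binomial_fps k = Abs_fps (\<lambda>l. (real k + real l - 1) gchoose l)"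

lemma neg_binomial_fps_0: "neg_binomial_fps 0 = 1"
proof (rule fps_ext)
  fix l
  show "neg_binomial_fps 0 $ l = 1 $ l"
  proof (cases l)
    case (Suc m)
    have "real l - 1 gchoose l = real (m choose l)"
      by (simp add: Suc binomial_gbinomial)
    then show ?thesis by (simp add: neg_binomial_fps_def Suc)
  qed (simp add: neg_binomial_fps_def)
qed

lemma neg_binomial_fps_Suc: "neg_binomial_fps (Suc k) * (1 - fps_X) = neg_binomial_fps k"
proof (rule fps_ext)
  fix l
  show "(neg_binomial_fps (Suc k) * (1 - fps_X)) $ l = neg_binomial_fps k $ l"
  proof (cases l)
    case (Suc m)
    have "real k + real m + 1 gchoose Suc m = (real k + real m gchoose m) + (real k + real m gchoose Suc m)"
      by (rule gbinomial_Suc_Suc)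
    then show ?thesis
      by (simp add: neg_binomial_fps_def Suc algebra_simps)
  qed (simp add: neg_binomial_fps_def algebra_simps)
qed

lemma one_plus_two_X_power_nth:
  "((1 + 2 * fps_X) ^ l :: real fps) $ m = real (l choose m) * 2 ^ m"
proof (induction l arbitrary: m)
  case 0
  then show ?case by (cases m) auto
next
  case (Suc l)
  have "((1 + 2 * fps_X) ^ Suc l :: real fps) $ m
      = ((1 + 2 * fps_X) ^ l + fps_const 2 * (fps_X * (1 + 2 * fps_X) ^ l) :: real fps) $ m"
    by (simp add: algebra_simps numeral_fps_const)
  also have "\<dots> = real (Suc l choose m) * 2 ^ m"
    unfolding fps_add_nth fps_mult_left_const_nth by (cases m) (simp_all add: Suc distrib_right)
  finally show ?case .
qed

lemma power_X2_2X3_nth: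
  "((fps_X ^ 2 + 2 * fps_X ^ 3) ^ l :: real fps) $ n =
     (if n < 2 * l then 0 else real (l choose (n - 2 * l)) * 2 ^ (n - 2 * l))"
proof -
  have "(fps_X ^ 2 + 2 * fps_X ^ 3 :: real fps) = fps_X ^ 2 * (1 + 2 * fps_X)"
    by (simp add: algebra_simps power2_eq_square power3_eq_cube)
  then have "(fps_X ^ 2 + 2 * fps_X ^ 3) ^ l = (fps_X ^ (2 * l) * (1 + 2 * fps_X) ^ l :: real fps)"
    by (simp only: power_mult_distrib power_mult)
  then show ?thesis
    by (simp only: fps_X_power_mult_nth one_plus_two_X_power_nth)
qed

definition denom_fps :: "real fps" where
  "denom_fps = 1 - fps_X ^ 2 - 2 * fps_X ^ 3"

lemma denom_fps_nth_0: "denom_fps $ 0 = 1"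
  by (simp add: denom_fps_def)

text \<open>In \<open>(x^2 + 2 x^3)^l = x^(2 l) (1 + 2 x)^l\<close> the coefficient of
  \<open>x^n\<close> chooses \<open>2 x\<close> from \<open>n - 2 l\<close> of the factors.\<close>

lemma t_eq_compose: "t n k = (neg_binomial_fps k oo (fps_X ^ 2 + 2 * fps_X ^ 3)) $ n"
proof -
  have "(neg_binomial_fps k oo (fps_X ^ 2 + 2 * fps_X ^ 3)) $ n =
      (\<Sum>l = 0..n. (real k + real l - 1 gchoose l) *
         (if n < 2 * l then 0 else real (l choose (n - 2 * l)) * 2 ^ (n - 2 * l)))"
    by (simp add: fps_compose_nth power_X2_2X3_nth neg_binomial_fps_def)
  also have "\<dots> = t n k"
    \<comment> \<open>For \<open>l > n div 2\<close> the power of \<open>x^2 + 2 x^3\<close> starts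
      beyond \<open>x^n\<close>.\<close>
    unfolding t_def by (rule sum.mono_neutral_cong_right) auto
  finally show ?thesis by simp
qed

text \<open>The substitution turns \<open>1 - x\<close> into \<open>denom_fps\<close>, hence
  \<open>(1 - x)^(-k)\<close> into the power of its inverse.\<close>

lemma t_eq_power_nth: "t n k = (inverse denom_fps ^ k) $ n"
proof -
  let ?Q = "fps_X ^ 2 + 2 * fps_X ^ 3 :: real fps"
  have Q0: "?Q $ 0 = 0" by simp
  have "neg_binomial_fps k oo ?Q = inverse denom_fps ^ k"
  proof (induction k)
    case 0
    then show ?case by (simp add: neg_binomial_fps_0)
  next
    case (Suc k)
    have "(1 - fps_X) oo ?Q = denom_fps"
      by (simp add: fps_compose_sub_distrib denom_fps_def fps_X_fps_compose_startby0)
    then have "(neg_binomial_fps (Suc k) oo ?Q) * denom_fps = neg_binomial_fps k oo ?Q"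
      by (metis fps_compose_mult_distrib[OF Q0] neg_binomial_fps_Suc)
    then have "(neg_binomial_fps (Suc k) oo ?Q) * (denom_fps * inverse denom_fps)
        = inverse denom_fps ^ k * inverse denom_fps"
      by (simp add: Suc flip: mult.assoc)
    then show ?case
      by (simp add: inverse_mult_eq_1' denom_fps_nth_0 mult.commute)
  qed
  then show ?thesis by (simp add: t_eq_compose)
qed

text \<open>The known object is \<open>r^k\<close> with \<open>r = z C(z^2)\<close>,
  \<open>C\<close> the Catalan series, so that \<open>r = z (1 + r^2)\<close>; Lagrange inversion
  gives these coefficients at \<open>z^(k + 2 j)\<close>. Only the recurrence of the powers is
  established below.\<close>

definition ballot_fps :: "nat \<Rightarrow> real fps" where
  "ballot_fps k = Abs_fps (\<lambda>m. if k \<le> m \<and> even (m - k) then ballot_factor k ((m - k) div 2) else 0)"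

lemma ballot_fps_0: "ballot_fps 0 = 1"
  by (rule fps_ext) (auto simp: ballot_fps_def ballot_factor_def)

lemma ballot_factor_0: "ballot_factor k 0 = 1"
  by (simp add: ballot_factor_def)

text \<open>Coefficient form of \<open>r^(k+1) = z (r^k + r^(k+2))\<close>. Pascal's rule and
  absorption express all binomials through \<open>N choose j\<close>, leaving a rational
  identity.\<close>

lemma ballot_factor_Suc_Suc:
  "ballot_factor (Suc k) (Suc j) = ballot_factor k (Suc j) + ballot_factor (Suc (Suc k)) j"
proof -
  define N where "N = k + 2 * j + 2"
  define c where "c = real (N choose j)"
  have le: "Suc j \<le> N" by (simp add: N_def)
  have "Suc j * (N choose Suc j) = (N - j) * (N choose j)"
    by (metis binomial_absorb_comp binomial_absorption diff_Suc_1)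
  then have "real (Suc j) * real (N choose Suc j) = real (k + j + 2) * c"
    unfolding c_def N_def of_nat_mult[symmetric] by simp
  then have c1: "real (N choose Suc j) = real (k + j + 2) / real (Suc j) * c"
    by (simp add: field_simps)
  have eqs: "Suc k + 2 * Suc j = Suc N" "k + 2 * Suc j = N" "Suc (Suc k) + 2 * j = N"
    by (simp_all add: N_def)
  have "ballot_factor (Suc k) (Suc j) = real (Suc k) / real (Suc N) * (real (N choose Suc j) + c)"
    unfolding ballot_factor_def eqs c_def by simp
  moreover have "ballot_factor k (Suc j) = real k / real N * real (N choose Suc j)"
    unfolding ballot_factor_def eqs by simp
  moreover have "ballot_factor (Suc (Suc k)) j = real (k + 2) / real N * c"
    unfolding ballot_factor_def eqs c_def by simp
  moreover have "real (Suc k) / real (Suc N) * (real (N choose Suc j) + c) =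
      real k / real N * real (N choose Suc j) + real (k + 2) / real N * c"
  proof -
    \<comment> \<open>With \<open>a\<close> and \<open>N\<close> as variables every remaining factor
      is linear, and \<open>algebra\<close> can finish once denominators are cleared.\<close>
    define a where "a = real j + 1"
    have nz: "a \<noteq> 0" "real N \<noteq> 0" "real N + 1 \<noteq> 0" by (auto simp: a_def N_def)
    have eqs: "real (Suc k) = real N - 2 * a + 1" "real k = real N - 2 * a"
        "real (k + j + 2) = real N + 1 - a" "real (k + 2) = real N - 2 * a + 2"
        "real (Suc j) = a" "real (Suc N) = real N + 1"
      by (simp_all add: a_def N_def)
    show ?thesis
      unfolding c1 eqs using nz
      by (simp only: times_divide_eq_left times_divide_eq_right divide_add_eq_iff add_divide_eq_iff
          eq_divide_eq divide_eq_eq refl if_True if_False nonzero_eq_divide_eq mult_eq_0_iff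
          simp_thms divide_divide_eq_left) algebra
  qed
  ultimately show ?thesis by simp
qed

lemma ballot_fps_Suc: "ballot_fps (Suc k) = fps_X * (ballot_fps k + ballot_fps (Suc (Suc k)))"
proof (rule fps_ext)
  fix m
  show "ballot_fps (Suc k) $ m = (fps_X * (ballot_fps k + ballot_fps (Suc (Suc k)))) $ m"
  proof (cases m)
    case (Suc p)
    show ?thesis
    proof (cases "k \<le> p \<and> even (p - k)")
      case True
      then obtain j where j: "p = k + 2 * j"
        by (metis dvdE le_add_diff_inverse)
      show ?thesis
      proof (cases j)
        case (Suc i)
        have "k + 2 * j - Suc (Suc k) = 2 * i" by (simp add: Suc)
        then show ?thesis
          using ballot_factor_Suc_Suc[of k i] \<open>m = Suc p\<close>
          by (simp add: ballot_fps_def j Suc)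
      qed (simp add: ballot_fps_def j \<open>m = Suc p\<close> ballot_factor_0)
    next
      case False
      then show ?thesis
        by (auto simp: ballot_fps_def Suc)
    qed
  qed (simp add: ballot_fps_def)
qed

section \<open>The double sum \<open>w\<close> as a power series\<close>

definition height_fps :: "nat \<Rightarrow> real fps" where
  "height_fps k = ballot_fps k oo (fps_X ^ 2 * inverse denom_fps)"

lemma height_fps_0: "height_fps 0 = 1"
  by (simp add: height_fps_def ballot_fps_0)

lemma height_fps_Suc:
  "denom_fps * height_fps (Suc k) = fps_X ^ 2 * (height_fps k + height_fps (Suc (Suc k)))"
proof -
  let ?Z = "fps_X ^ 2 * inverse denom_fps"
  have Z0: "?Z $ 0 = 0" by simp
  have "height_fps (Suc k) = ?Z * (height_fps k + height_fps (Suc (Suc k)))"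
    unfolding height_fps_def
    by (subst ballot_fps_Suc)
      (simp add: fps_compose_mult_distrib[OF Z0] fps_compose_add_distrib fps_X_fps_compose_startby0)
  then have "denom_fps * height_fps (Suc k) =
      (inverse denom_fps * denom_fps) * (fps_X ^ 2 * (height_fps k + height_fps (Suc (Suc k))))"
    by (simp add: mult_ac)
  then show ?thesis
    by (simp add: inverse_mult_eq_1 denom_fps_nth_0)
qed

text \<open>The inner sum of \<open>w\<close>. The term \<open>z^m\<close> with
  \<open>m = k + 2 j\<close> carries the factor \<open>x^(2 m)\<close>, whence the shift by
  \<open>4 j + 2 k\<close>, and the \<open>m\<close>-th power of \<open>inverse denom_fps\<close>,
  whence the second argument of \<open>t\<close>.\<close>

lemma height_fps_nth:
  "height_fps k $ n = (\<Sum>j = 0..(int n - 2 * int k) div 4.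
     ballot_factor k (nat j) * t (nat (int n - 4 * j - 2 * int k)) (2 * nat j + k))"
proof -
  have "((fps_X ^ 2 * inverse denom_fps) ^ m) $ n = (if n < 2 * m then 0 else t (n - 2 * m) m)" for m
    unfolding power_mult_distrib power_mult[symmetric] fps_X_power_mult_nth t_eq_power_nth ..
  then have "height_fps k $ n =
      (\<Sum>m = 0..n. ballot_fps k $ m * (if n < 2 * m then 0 else t (n - 2 * m) m))"
    by (simp only: height_fps_def fps_compose_nth)
  also have "\<dots> = (\<Sum>m \<in> {m. k \<le> m \<and> even (m - k) \<and> 2 * m \<le> n}.
      ballot_fps k $ m * (if n < 2 * m then 0 else t (n - 2 * m) m))"
    by (rule sum.mono_neutral_right) (auto simp: ballot_fps_def)
  also have "\<dots> = (\<Sum>j = 0..(int n - 2 * int k) div 4.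
     ballot_factor k (nat j) * t (nat (int n - 4 * j - 2 * int k)) (2 * nat j + k))"
  \<comment> \<open>Under \<open>m = k + 2 j\<close> the condition \<open>2 m \<le> n\<close> is the
    bound \<open>(n - 2 k) div 4\<close> on \<open>j\<close>; for \<open>n < 2 k\<close> both sums
    are empty.\<close>
  proof (rule sum.reindex_bij_witness
      [where i = "\<lambda>j. k + 2 * nat j" and j = "\<lambda>m. int ((m - k) div 2)"])
    fix m assume "m \<in> {m. k \<le> m \<and> even (m - k) \<and> 2 * m \<le> n}"
    then have "k \<le> m" "even (m - k)" "2 * m \<le> n" by auto
    then obtain j where j: "m = k + 2 * j" by (metis dvdE le_add_diff_inverse)
    with \<open>2 * m \<le> n\<close> have le: "2 * k + 4 * j \<le> n" by simp
    show "k + 2 * nat (int ((m - k) div 2)) = m" by (simp add: j)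
    show "int ((m - k) div 2) \<in> {0..(int n - 2 * int k) div 4}"
      using le by (simp add: j)
    have "nat (int n - 4 * int j - 2 * int k) = n - 2 * m" using le j by simp
    then show "ballot_factor k (nat (int ((m - k) div 2))) *
        t (nat (int n - 4 * int ((m - k) div 2) - 2 * int k)) (2 * nat (int ((m - k) div 2)) + k)
      = ballot_fps k $ m * (if n < 2 * m then 0 else t (n - 2 * m) m)"
      using le by (simp add: j ballot_fps_def add.commute)
  qed auto
  finally show ?thesis .
qed

definition w_fps :: "nat \<Rightarrow> real fps" where
  "w_fps k = Abs_fps (\<lambda>n. w (int n) k)"

lemma one_plus_X_times_w_fps: "(1 + fps_X) * w_fps k = height_fps k"
proof -
  let ?alt = "Abs_fps (\<lambda>n. (- 1) ^ n :: real)"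
  have "w (int n) k = (?alt * height_fps k) $ n" for n
  proof -
    have "w (int n) k = (\<Sum>i = 0..int n. (- 1) ^ nat i * height_fps k $ (n - nat i))"
      unfolding w_def
    proof (rule sum.cong)
      fix i assume "i \<in> {0..int n}"
      then have "int (n - nat i) = int n - i" by auto
      then show "(- 1) ^ nat i * (\<Sum>j = 0..(int n - i - 2 * int k) div 4. ballot_factor k (nat j) *
          t (nat (int n - i - 4 * j - 2 * int k)) (2 * nat j + k))
        = (- 1) ^ nat i * height_fps k $ (n - nat i)"
        by (simp add: height_fps_nth)
    qed simp
    also have "\<dots> = (\<Sum>i = 0..n. (- 1) ^ i * height_fps k $ (n - i))"
      by (rule sum.reindex_bij_witness[where i = int and j = nat]) auto
    finally show ?thesis by (simp add: fps_mult_nth)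
  qed
  then have "w_fps k = ?alt * height_fps k"
    by (simp add: w_fps_def fps_eq_iff)
  moreover have "(1 + fps_X) * ?alt = 1"
  proof (rule fps_ext)
    fix n show "((1 + fps_X) * ?alt) $ n = 1 $ n"
      by (cases n) (simp_all add: distrib_right)
  qed
  ultimately show ?thesis
    by (simp flip: mult.assoc)
qed

section \<open>Generating functions of the paths\<close>

definition A_fps :: "nat \<Rightarrow> real fps" where
  "A_fps k = Abs_fps (\<lambda>n. real (num_paths n (vertices_A (int k))))"

definition B_fps :: "nat \<Rightarrow> real fps" where
  "B_fps k = Abs_fps (\<lambda>n. real (num_paths n (vertices_B (int k))))"

definition C_fps :: "nat \<Rightarrow> real fps" where
  "C_fps k = Abs_fps (\<lambda>n. real (num_paths n (vertices_C (int k))))"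

text \<open>The constant 1 is the empty path.\<close>

lemma A_fps_0: "A_fps 0 = 1 + fps_X * C_fps 0"
proof (rule fps_ext)
  fix n show "A_fps 0 $ n = (1 + fps_X * C_fps 0) $ n"
    by (cases n) (simp_all add: A_fps_def C_fps_def num_paths_0 num_paths_Suc_A num_paths_B_neg)
qed

lemma A_fps_Suc: "A_fps (Suc k) = fps_X * (B_fps k + C_fps (Suc k))"
proof (rule fps_ext)
  fix n show "A_fps (Suc k) $ n = (fps_X * (B_fps k + C_fps (Suc k))) $ n"
    by (cases n) (simp_all add: A_fps_def B_fps_def C_fps_def num_paths_0 num_paths_Suc_A)
qed

lemma B_fps_eq: "B_fps k = fps_X * (A_fps k + C_fps k)"
proof (rule fps_ext)
  fix n show "B_fps k $ n = (fps_X * (A_fps k + C_fps k)) $ n"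
    by (cases n) (simp_all add: A_fps_def B_fps_def C_fps_def num_paths_0 num_paths_Suc_B)
qed

lemma C_fps_eq: "C_fps k = fps_X * (A_fps (Suc k) + B_fps k)"
proof (rule fps_ext)
  fix n show "C_fps k $ n = (fps_X * (A_fps (Suc k) + B_fps k)) $ n"
    by (cases n) (simp_all add: A_fps_def B_fps_def C_fps_def num_paths_0 num_paths_Suc_C add.commute)
qed

text \<open>The equations for B and C at one height form a 2 by 2 linear system with determinant
  \<open>1 - x^2\<close>.\<close>

lemma B_fps_solved: "(1 - fps_X ^ 2) * B_fps k = fps_X * A_fps k + fps_X ^ 2 * A_fps (Suc k)"
  using B_fps_eq[of k] C_fps_eq[of k] by algebra

lemma C_fps_solved: "(1 - fps_X ^ 2) * C_fps k = fps_X * A_fps (Suc k) + fps_X ^ 2 * A_fps k"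
  using B_fps_eq[of k] C_fps_eq[of k] by algebra

lemma A_fps_recurrence:
  "denom_fps * A_fps (Suc k) = fps_X ^ 2 * (A_fps k + A_fps (Suc (Suc k)))"
  unfolding denom_fps_def using A_fps_Suc[of k] B_fps_solved[of k] C_fps_solved[of "Suc k"] by algebra

text \<open>On the axis vertices are entered only from C, so just one of the two \<open>x^3\<close>
  terms of \<open>denom_fps\<close> appears.\<close>

lemma A_fps_recurrence_0:
  "(1 - fps_X ^ 2 - fps_X ^ 3) * A_fps 0 = 1 - fps_X ^ 2 + fps_X ^ 2 * A_fps 1"
  using A_fps_0 C_fps_solved[of 0] unfolding One_nat_def by algebra

lemma one_minus_X_times_B_plus_C:
  "(1 - fps_X) * (B_fps k + C_fps k) = fps_X * (A_fps k + A_fps (Suc k))"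
  using B_fps_eq[of k] C_fps_eq[of k] by algebra

text \<open>Solved for \<open>E k\<close>, every term on the right has a factor \<open>x^2\<close>,
  so all coefficients vanish by strong induction on the exponent, for all \<open>k\<close> at
  once.\<close>

lemma recurrence_unique:
  fixes E :: "nat \<Rightarrow> real fps"
  assumes "\<And>k. denom_fps * E (Suc k) = fps_X ^ 2 * (E k + E (Suc (Suc k)))"
    and "(1 - fps_X ^ 2 - fps_X ^ 3) * E 0 = fps_X ^ 2 * E 1"
  shows "E k = 0"
proof -
  \<comment> \<open>Nested factors \<open>fps_X\<close> and a doubled summand let simplification
    reduce each coefficient to ones of smaller index.\<close>
  have E_Suc: "E (Suc k) = fps_X * (fps_X * (E k + E (Suc k) + E (Suc (Suc k)))
      + fps_X * (fps_X * (E (Suc k) + E (Suc k))))" for k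
    using assms(1)[of k] unfolding denom_fps_def by algebra
  have E_0: "E 0 = fps_X * (fps_X * (E 0 + E (Suc 0)) + fps_X * (fps_X * E 0))"
    using assms(2) unfolding One_nat_def by algebra
  have "E k $ n = 0" for n
  proof (induction n arbitrary: k rule: less_induct)
    case (less n)
    show ?case
    proof (cases k)
      case 0
      show ?thesis unfolding 0 by (subst E_0) (simp add: less)
    next
      case (Suc j)
      show ?thesis unfolding Suc by (subst E_Suc) (simp add: less)
    qed
  qed
  then show ?thesis by (simp add: fps_eq_iff)
qed

section \<open>Identifying the path series with combinations of \<open>w\<close>\<close>

lemma w_fps_recurrence:
  "denom_fps * w_fps (Suc k) = fps_X ^ 2 * (w_fps k + w_fps (Suc (Suc k)))"
proof -
  have "(1 + fps_X) * (denom_fps * w_fps (Suc k)) =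
      (1 + fps_X) * (fps_X ^ 2 * (w_fps k + w_fps (Suc (Suc k))))"
    using height_fps_Suc[of k] unfolding one_plus_X_times_w_fps[symmetric] by algebra
  moreover have "(1 + fps_X :: real fps) \<noteq> 0"
    by (auto simp: fps_eq_iff intro!: exI[of _ 0])
  ultimately show ?thesis by simp
qed

text \<open>The factor \<open>x\<close> accounts for the shifted argument \<open>n + 1\<close> of
  \<open>w\<close>: the formula is read off at exponent \<open>n + 1\<close>.\<close>

lemma X_times_A_fps: "fps_X * A_fps k = fps_X * w_fps k + w_fps (Suc k)"
proof -
  define E where "E k = fps_X * A_fps k - (fps_X * w_fps k + w_fps (Suc k))" for k
  have "E k = 0"
  proof (rule recurrence_unique)
    show "denom_fps * E (Suc k) = fps_X ^ 2 * (E k + E (Suc (Suc k)))" for k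
      unfolding E_def using A_fps_recurrence[of k] w_fps_recurrence[of k] w_fps_recurrence[of "Suc k"]
      by algebra
  next
    \<comment> \<open>After the recurrence is used, the \<open>w_fps 0\<close> terms combine to
      \<open>x (1 - x^2) (1 + x)\<close> times \<open>w_fps 0\<close>, which cancels the
      inhomogeneous term \<open>x (1 - x^2)\<close> of the path equation.\<close>
    have w0: "(1 + fps_X) * w_fps 0 = 1"
      by (simp add: one_plus_X_times_w_fps height_fps_0)
    show "(1 - fps_X ^ 2 - fps_X ^ 3) * E 0 = fps_X ^ 2 * E 1"
      using A_fps_recurrence_0 w_fps_recurrence[of 0] w0 unfolding E_def denom_fps_def One_nat_def
      by algebra
  qed
  then show ?thesis by (simp add: E_def)
qed

text \<open>Eliminating \<open>w_fps k\<close> by the recurrence leaves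
  \<open>1 + x - 2 x^3 = (1 - x) (1 + 2 x + 2 x^2)\<close> as the factor of
  \<open>w_fps (Suc k)\<close>; this is the source of the coefficients 1, 2, 2.\<close>

lemma X_times_B_plus_C_fps:
  "fps_X * (B_fps k + C_fps k) = fps_X * w_fps (Suc (Suc k)) + 2 * fps_X ^ 2 * w_fps (Suc k)
     + 2 * fps_X * w_fps (Suc k) + w_fps (Suc k)"
    (is "?l = ?r")
proof -
  have "(1 - fps_X) * ?l = (1 - fps_X) * ?r"
    using one_minus_X_times_B_plus_C[of k] X_times_A_fps[of k] X_times_A_fps[of "Suc k"]
      w_fps_recurrence[of k] unfolding denom_fps_def by algebra
  moreover have "(1 - fps_X :: real fps) \<noteq> 0"
    by (auto simp: fps_eq_iff intro!: exI[of _ 0])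
  ultimately show ?thesis by simp
qed

lemma s_even_eq: "real (s n (2 * int k)) = w (int n) k + w (int n + 1) (k + 1)"
proof -
  have "(fps_X * A_fps k) $ Suc n = (fps_X * w_fps k + w_fps (Suc k)) $ Suc n"
    by (simp only: X_times_A_fps)
  then show ?thesis
    by (simp add: A_fps_def w_fps_def s_even add.commute)
qed

lemma s_odd_eq:
  "real (s n (2 * int (Suc k) - 1)) = w (int n) (Suc (Suc k)) + 2 * w (int n - 1) (Suc k)
     + 2 * w (int n) (Suc k) + w (int n + 1) (Suc k)"
proof -
  have "(fps_X * (B_fps k + C_fps k)) $ Suc n =
      (fps_X * w_fps (Suc (Suc k)) + fps_X * (fps_X * (fps_const 2 * w_fps (Suc k)))
     + fps_X * (fps_const 2 * w_fps (Suc k)) + w_fps (Suc k)) $ Suc n"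
    by (simp only: X_times_B_plus_C_fps power2_eq_square numeral_fps_const mult_ac)
  \<comment> \<open>At \<open>n = 0\<close> the argument \<open>n - 1\<close> is outside the range
    of \<open>w_fps\<close>; the sum is empty there.\<close>
  moreover have "w (- 1) (Suc k) = 0" by (simp add: w_def)
  moreover have height: "2 * int (Suc k) - 1 = 2 * int k + 1" by simp
  ultimately show ?thesis
    unfolding height s_odd by (cases n) (simp_all add: B_fps_def C_fps_def w_fps_def add.commute)
qed

theorem theorem5:
  fixes n :: nat
  shows "(\<forall>k::nat. real (s n (2 * int k)) = w (int n) k + w (int n + 1) (k + 1)) \<and>
         (\<forall>k::nat. k \<ge> 1 \<longrightarrow>
            real (s n (2 * int k - 1)) =
              w (int n) (k + 1) + 2 * w (int n - 1) k + 2 * w (int n) k + w (int n + 1) k) \<and>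
         (\<forall>k::int. k < 0 \<longrightarrow> s n k = 0)"
proof (intro conjI allI impI)
  fix k :: nat assume "1 \<le> k"
  then obtain j where "k = Suc j" by (cases k) auto
  then show "real (s n (2 * int k - 1)) =
      w (int n) (k + 1) + 2 * w (int n - 1) k + 2 * w (int n) k + w (int n + 1) k"
    using s_odd_eq[of n j] by simp
qed (simp_all add: s_even_eq s_neg)

end
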